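(* For $\mathcal{B}=\{b^{i,j}\}_{i,j=1}^4\in(\ell^1_{\delta,2})^{4\times4}$, let $\tilde{\mathcal W}_\alpha=(\tilde w^{i,j}_\alpha)$ and $\mathcal{A}_\alpha=(a^{i,j}_\alpha)$ be the sequences associated with $\mathcal{B}$ as in the context, $\mathcal{W}_\alpha=\mathcal{W}_0\tilde{\mathcal W}_\alpha$, and define the $4\times 4$ matrix-valued functions on $B^2_\delta(0)$ $$\mathcal{W}(\sigma)=\sum_{|\alpha|\ge0}\mathcal{W}_\alpha\sigma^\alpha,\qquad \mathcal{A}(\sigma)=\sum_{|\alpha|\ge0}\mathcal{A}_\alpha\sigma^\alpha .$$ If $\mathcal{B}=\Psi(\mathcal{B})$, then the conjugacy equation $$DG(P(\sigma))\,\mathcal{W}(\sigma)=D\mathcal{W}(\sigma)\,\Omega^{\mathrm{s}}\sigma+\mathcal{W}(\sigma)\mathcal{A}(\sigma)$$ is satisfied for $\sigma\in B^2_\delta(0)$.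
   Context: Fix $\hat\mu,\hat\nu>0$, $f(u)=\hat\nu u^2-u^3-\hat\mu u$, and the vector field $G(u_1,u_2,u_3,u_4)=(u_2,u_3,u_4,-2u_3-u_1+f(u_1))$. Let $\rho=\sqrt{1+\hat\mu}$, $\tan\theta=-\sqrt{\hat\mu}$, $\theta\in(\pi/2,\pi)$. The eigenvalues of $DG(0)$ are $\mu_1=\mu_1^{\mathrm{s}}=-\sqrt\rho e^{i\theta/2}$, $\mu_2=\mu_2^{\mathrm{s}}=-\sqrt\rho e^{-i\theta/2}$, $\mu_3=\mu_1^{\mathrm{u}}=-\mu_1^{\mathrm{s}}$, $\mu_4=\mu_2^{\mathrm{u}}=-\mu_2^{\mathrm{s}}$. Let $\Omega^{\mathrm{s}}=\mathrm{diag}(\mu_1,\mu_2)$, $\Omega=\mathrm{diag}(\mu_1,\mu_2,\mu_3,\mu_4)$, and let $\mathcal{W}_0$ be a matrix whose $j$th column is an eigenvector of $DG(0)$ for $\mu_j$. Notation: $\alpha\in\mathbb{N}^2$, $\mathbb{N}=\{0,1,\dots\}$, $|\alpha|=\alpha_1+\alpha_2$, $\sigma^\alpha=\sigma_1^{\alpha_1}\sigma_2^{\alpha_2}$. $\ell^1_{\delta,2}$ is the space of complex sequences $b=\{b_\alpha\}_{\alpha\in\mathbb{N}^2}$ with $\sum_\alpha|b_\alpha|\delta^{|\alpha|}<\infty$. $B^2_\delta(0)=\{\sigma\in\mathbb{C}^2:|\sigma_1|,|\sigma_2|\le\delta\}$. $P(\sigma)=\sum_\alpha P_\alpha\sigma^\alpha$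 with $\{P_\alpha\}\in(\ell^1_{\delta,2})^4$ is a fixed parameterization of the stable manifold of $0$: $P(0)=0$, $DP(0)$ has as columns eigenvectors for $\mu_1,\mu_2$, and $G(P(\sigma))=DP(\sigma)\Omega^{\mathrm{s}}\sigma$. Write $DG(P(\sigma))=\sum_\alpha\hat G_\alpha\sigma^\alpha$ (so $\hat G_0=DG(0)$). For matrix sequences, $(b\,\hat*\,\tilde b)_\alpha=\sum_{\beta\le\alpha,\,\beta\ne0,\,\beta\ne\alpha}b_{\alpha-\beta}\tilde b_\beta$ (componentwise $\le$). Resonances: $\mathrm{Res}_{i,j}=\{\alpha\in\mathbb{N}^2:|\alpha|\ge1,\ \alpha_1\mu_1+\alpha_2\mu_2+\mu_j-\mu_i=0\}$. Association: for $|\alpha|\ge1$, $b^{i,j}\mapsto(\tilde w^{i,j},a^{i,j})$ is given by $\tilde w^{i,j}_\alpha=0$, $a^{i,j}_\alpha=b^{i,j}_\alpha$ if $\alpha\in\mathrm{Res}_{i,j}$, and $\tilde w^{i,j}_\alpha=b^{i,j}_\alpha$, $a^{i,j}_\alpha=0$ if $\alpha\notin\mathrm{Res}_{i,j}$; at order zero $\tilde{\mathcal W}_0=\mathcal{B}_0$ and $\mathcal{A}_0=\Omega$. The map $\Psi:(\ell^1_{\delta,2})^{4\times4}\to(\ell^1_{\delta,2})^{4\times4}$: $\Psi(\mathcal{B})_0=I$, and for $|\alpha|\ge1$ the $(i,j)$ entry of $\Psi(\mathcal{B})_\alpha$ is $\kappa^{i,j}_\alpha\,(\mathcal{W}_0^{-1}\mathcal{S}_\alpha)^{i,j}$,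 where $\kappa^{i,j}_\alpha=1$ if $\alpha\in\mathrm{Res}_{i,j}$ and $\kappa^{i,j}_\alpha=(\alpha_1\mu_1+\alpha_2\mu_2+\mu_j-\mu_i)^{-1}$ otherwise, and $$\mathcal{S}_\alpha=\hat G_\alpha\mathcal{W}_0+(\hat G\,\hat*\,\mathcal{W})_\alpha-(\mathcal{W}\,\hat*\,\mathcal{A})_\alpha,$$ with $\mathcal{W}_\alpha=\mathcal{W}_0\tilde{\mathcal W}_\alpha$, where $\tilde{\mathcal W}_\alpha=(\tilde w^{i,j}_\alpha)$ and $\mathcal{A}_\alpha=(a^{i,j}_\alpha)$ are obtained from $\mathcal{B}=\{b^{i,j}\}$ by setting, for $|\alpha|\ge1$, $(\tilde w^{i,j}_\alpha,a^{i,j}_\alpha)=(0,b^{i,j}_\alpha)$ if $\alpha\in\mathrm{Res}_{i,j}$ and $(\tilde w^{i,j}_\alpha,a^{i,j}_\alpha)=(b^{i,j}_\alpha,0)$ if $\alpha\notin\mathrm{Res}_{i,j}$, and, at order zero, $\tilde{\mathcal W}_0=\mathcal{B}_0$ and $\mathcal{A}_0=\Omega$. $D\mathcal{W}(\sigma)\Omega^{\mathrm{s}}\sigma$ is the derivative of $\mathcal{W}$ in direction $\Omega^{\mathrm{s}}\sigma$, i.e. $\sum_\alpha(\alpha_1\mu_1+\alpha_2\mu_2)\mathcal{W}_\alpha\sigma^\alpha$. *)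

theory Defs
  imports "HOL-Analysis.Analysis"
begin

text \<open>
  Multi-indices in \<open>\<nat>\<^sup>2\<close> are pairs of naturals. A 4-vector or a 4x4 matrix of sequences is a
  function from multi-indices to \<^typ>\<open>complex ^ 4\<close> or \<^typ>\<open>complex ^ 4 ^ 4\<close>; the \<open>(i,j)\<close>
  entry of a matrix \<open>M\<close> is \<open>M $ i $ j\<close>.
\<close>

type_synonym mindex = "nat \<times> nat"

definition monom2 :: "complex ^ 2 \<Rightarrow> mindex \<Rightarrow> complex" where
  "monom2 \<sigma> \<alpha> = (\<sigma> $ 1) ^ fst \<alpha> * (\<sigma> $ 2) ^ snd \<alpha>"

definition ell1 :: "real \<Rightarrow> (mindex \<Rightarrow> complex) set" where
  "ell1 \<delta> = {b. (\<lambda>\<alpha>. cmod (b \<alpha>) * \<delta> ^ (fst \<alpha> + snd \<alpha>)) summable_on UNIV}"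

definition ell1_vec :: "real \<Rightarrow> (mindex \<Rightarrow> complex ^ 4) set" where
  "ell1_vec \<delta> = {b. \<forall>i. (\<lambda>\<alpha>. b \<alpha> $ i) \<in> ell1 \<delta>}"

definition ell1_mat :: "real \<Rightarrow> (mindex \<Rightarrow> complex ^ 4 ^ 4) set" where
  "ell1_mat \<delta> = {b. \<forall>i j. (\<lambda>\<alpha>. b \<alpha> $ i $ j) \<in> ell1 \<delta>}"

definition polydisc :: "real \<Rightarrow> (complex ^ 2) set" where
  "polydisc \<delta> = {\<sigma>. cmod (\<sigma> $ 1) \<le> \<delta> \<and> cmod (\<sigma> $ 2) \<le> \<delta>}"

definition power_series :: "(mindex \<Rightarrow> complex) \<Rightarrow> complex ^ 2 \<Rightarrow> complex" where
  "power_series b \<sigma> = (\<Sum>\<^sub>\<infinity>\<alpha>. b \<alpha> * monom2 \<sigma> \<alpha>)"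

definition vec_series :: "(mindex \<Rightarrow> complex ^ 4) \<Rightarrow> complex ^ 2 \<Rightarrow> complex ^ 4" where
  "vec_series b \<sigma> = (\<chi> i. power_series (\<lambda>\<alpha>. b \<alpha> $ i) \<sigma>)"

definition mat_series :: "(mindex \<Rightarrow> complex ^ 4 ^ 4) \<Rightarrow> complex ^ 2 \<Rightarrow> complex ^ 4 ^ 4" where
  "mat_series b \<sigma> = (\<chi> i j. power_series (\<lambda>\<alpha>. b \<alpha> $ i $ j) \<sigma>)"

definition f_nl :: "real \<Rightarrow> real \<Rightarrow> complex \<Rightarrow> complex" where
  "f_nl \<mu>h \<nu>h u = of_real \<nu>h * u ^ 2 - u ^ 3 - of_real \<mu>h * u"

definition G_field :: "real \<Rightarrow> real \<Rightarrow> complex ^ 4 \<Rightarrow> complex ^ 4" where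
  "G_field \<mu>h \<nu>h u =
     vector [u $ 2, u $ 3, u $ 4, - 2 * u $ 3 - u $ 1 + f_nl \<mu>h \<nu>h (u $ 1)]"

text \<open>
  The Frechet derivative is taken over the reals; for a holomorphic map it is complex linear,
  so that its matrix is the complex Jacobian matrix.
\<close>

definition cjacobian :: "(complex ^ 'n \<Rightarrow> complex ^ 'm) \<Rightarrow> complex ^ 'n \<Rightarrow> complex ^ 'n ^ 'm" where
  "cjacobian F x = matrix (frechet_derivative F (at x))"

definition DG :: "real \<Rightarrow> real \<Rightarrow> complex ^ 4 \<Rightarrow> complex ^ 4 ^ 4" where
  "DG \<mu>h \<nu>h = cjacobian (G_field \<mu>h \<nu>h)"

definition eigs :: "real \<Rightarrow> real \<Rightarrow> complex ^ 4" where
  "eigs \<mu>h \<theta> =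
     (let s = of_real (sqrt (sqrt (1 + \<mu>h)));
          m1 = - s * exp (\<i> * of_real \<theta> / 2);
          m2 = - s * exp (- \<i> * of_real \<theta> / 2)
      in vector [m1, m2, - m1, - m2])"

definition Omega :: "complex ^ 4 \<Rightarrow> complex ^ 4 ^ 4" where
  "Omega \<mu> = (\<chi> i j. if i = j then \<mu> $ i else 0)"

definition eigenvector_of :: "complex ^ 'n ^ 'n \<Rightarrow> complex \<Rightarrow> complex ^ 'n \<Rightarrow> bool" where
  "eigenvector_of A l v \<longleftrightarrow> v \<noteq> 0 \<and> A *v v = l *s v"

definition stable_dot :: "complex ^ 4 \<Rightarrow> mindex \<Rightarrow> complex" where
  "stable_dot \<mu> \<alpha> = of_nat (fst \<alpha>) * \<mu> $ 1 + of_nat (snd \<alpha>) * \<mu> $ 2"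

text \<open>
  The derivative of a power series at \<open>\<sigma>\<close> in the direction
  \<open>\<Omega>\<^sup>s \<sigma> = (\<mu>\<^sub>1 \<sigma>\<^sub>1, \<mu>\<^sub>2 \<sigma>\<^sub>2)\<close>, differentiated term by term: \<open>\<sigma>\<^sup>\<alpha>\<close> becomes
  \<open>(\<alpha>\<^sub>1 \<mu>\<^sub>1 + \<alpha>\<^sub>2 \<mu>\<^sub>2) \<sigma>\<^sup>\<alpha>\<close>. Membership of the coefficients in \<open>\<ell>\<^sup>1\<close> alone does not give
  convergence on the boundary of the polydisc, where an infinite sum could silently be 0, so
  convergence is a separate predicate.
\<close>

definition dir_coeff :: "complex ^ 4 \<Rightarrow> (mindex \<Rightarrow> complex) \<Rightarrow> mindex \<Rightarrow> complex" where
  "dir_coeff \<mu> b = (\<lambda>\<alpha>. stable_dot \<mu> \<alpha> * b \<alpha>)"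

definition dir_converges :: "complex ^ 4 \<Rightarrow> (mindex \<Rightarrow> complex) \<Rightarrow> complex ^ 2 \<Rightarrow> bool" where
  "dir_converges \<mu> b \<sigma> \<longleftrightarrow> (\<lambda>\<alpha>. dir_coeff \<mu> b \<alpha> * monom2 \<sigma> \<alpha>) summable_on UNIV"

definition vec_dir_deriv ::
    "complex ^ 4 \<Rightarrow> (mindex \<Rightarrow> complex ^ 4) \<Rightarrow> complex ^ 2 \<Rightarrow> complex ^ 4" where
  "vec_dir_deriv \<mu> b \<sigma> = (\<chi> i. power_series (dir_coeff \<mu> (\<lambda>\<alpha>. b \<alpha> $ i)) \<sigma>)"

definition mat_dir_deriv ::
    "complex ^ 4 \<Rightarrow> (mindex \<Rightarrow> complex ^ 4 ^ 4) \<Rightarrow> complex ^ 2 \<Rightarrow> complex ^ 4 ^ 4" where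
  "mat_dir_deriv \<mu> b \<sigma> = (\<chi> i j. power_series (dir_coeff \<mu> (\<lambda>\<alpha>. b \<alpha> $ i $ j)) \<sigma>)"

definition is_parameterization ::
    "real \<Rightarrow> real \<Rightarrow> complex ^ 4 \<Rightarrow> real \<Rightarrow> (mindex \<Rightarrow> complex ^ 4) \<Rightarrow> bool" where
  "is_parameterization \<mu>h \<nu>h \<mu> \<delta> p \<longleftrightarrow>
     p \<in> ell1_vec \<delta> \<and>
     vec_series p 0 = 0 \<and>
     eigenvector_of (DG \<mu>h \<nu>h 0) (\<mu> $ 1) (column 1 (cjacobian (vec_series p) 0)) \<and>
     eigenvector_of (DG \<mu>h \<nu>h 0) (\<mu> $ 2) (column 2 (cjacobian (vec_series p) 0)) \<and>
     (\<forall>\<sigma>\<in>polydisc \<delta>.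
        (\<forall>i. dir_converges \<mu> (\<lambda>\<alpha>. p \<alpha> $ i) \<sigma>) \<and>
        G_field \<mu>h \<nu>h (vec_series p \<sigma>) = vec_dir_deriv \<mu> p \<sigma>)"

text \<open>
  The sum is unconditional, so on a polydisc of positive radius this determines the coefficients
  and puts them in \<open>\<ell>\<^sup>1\<close>.
\<close>

definition is_expansion_on ::
    "(complex ^ 2) set \<Rightarrow> (complex ^ 2 \<Rightarrow> complex ^ 4 ^ 4) \<Rightarrow> (mindex \<Rightarrow> complex ^ 4 ^ 4) \<Rightarrow> bool" where
  "is_expansion_on D F c \<longleftrightarrow>
     (\<forall>\<sigma>\<in>D. \<forall>i j. ((\<lambda>\<alpha>. c \<alpha> $ i $ j * monom2 \<sigma> \<alpha>) has_sum F \<sigma> $ i $ j) UNIV)"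

definition Res :: "complex ^ 4 \<Rightarrow> 4 \<Rightarrow> 4 \<Rightarrow> mindex set" where
  "Res \<mu> i j = {\<alpha>. fst \<alpha> + snd \<alpha> \<ge> 1 \<and> stable_dot \<mu> \<alpha> + \<mu> $ j - \<mu> $ i = 0}"

definition Wtilde :: "complex ^ 4 \<Rightarrow> (mindex \<Rightarrow> complex ^ 4 ^ 4) \<Rightarrow> mindex \<Rightarrow> complex ^ 4 ^ 4" where
  "Wtilde \<mu> B \<alpha> =
     (if \<alpha> = (0, 0) then B (0, 0)
      else (\<chi> i j. if \<alpha> \<in> Res \<mu> i j then 0 else B \<alpha> $ i $ j))"

definition Acoeff :: "complex ^ 4 \<Rightarrow> (mindex \<Rightarrow> complex ^ 4 ^ 4) \<Rightarrow> mindex \<Rightarrow> complex ^ 4 ^ 4" where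
  "Acoeff \<mu> B \<alpha> =
     (if \<alpha> = (0, 0) then Omega \<mu>
      else (\<chi> i j. if \<alpha> \<in> Res \<mu> i j then B \<alpha> $ i $ j else 0))"

definition Wcoeff ::
    "complex ^ 4 \<Rightarrow> complex ^ 4 ^ 4 \<Rightarrow> (mindex \<Rightarrow> complex ^ 4 ^ 4) \<Rightarrow> mindex \<Rightarrow> complex ^ 4 ^ 4" where
  "Wcoeff \<mu> W0 B \<alpha> = W0 ** Wtilde \<mu> B \<alpha>"

text \<open>The Cauchy product without its two extreme terms.\<close>

definition hat_conv ::
    "(mindex \<Rightarrow> complex ^ 4 ^ 4) \<Rightarrow> (mindex \<Rightarrow> complex ^ 4 ^ 4) \<Rightarrow> mindex \<Rightarrow> complex ^ 4 ^ 4" where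
  "hat_conv b c \<alpha> =
     (\<Sum>\<beta> \<in> {\<beta>. fst \<beta> \<le> fst \<alpha> \<and> snd \<beta> \<le> snd \<alpha> \<and> \<beta> \<noteq> (0, 0) \<and> \<beta> \<noteq> \<alpha>}.
        b (fst \<alpha> - fst \<beta>, snd \<alpha> - snd \<beta>) ** c \<beta>)"

definition S_coeff ::
    "complex ^ 4 \<Rightarrow> complex ^ 4 ^ 4 \<Rightarrow> (mindex \<Rightarrow> complex ^ 4 ^ 4) \<Rightarrow> (mindex \<Rightarrow> complex ^ 4 ^ 4)
      \<Rightarrow> mindex \<Rightarrow> complex ^ 4 ^ 4" where
  "S_coeff \<mu> W0 Gh B \<alpha> =
     Gh \<alpha> ** W0 + hat_conv Gh (Wcoeff \<mu> W0 B) \<alpha> - hat_conv (Wcoeff \<mu> W0 B) (Acoeff \<mu> B) \<alpha>"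

definition kappa :: "complex ^ 4 \<Rightarrow> 4 \<Rightarrow> 4 \<Rightarrow> mindex \<Rightarrow> complex" where
  "kappa \<mu> i j \<alpha> =
     (if \<alpha> \<in> Res \<mu> i j then 1 else inverse (stable_dot \<mu> \<alpha> + \<mu> $ j - \<mu> $ i))"

definition Psi ::
    "complex ^ 4 \<Rightarrow> complex ^ 4 ^ 4 \<Rightarrow> (mindex \<Rightarrow> complex ^ 4 ^ 4) \<Rightarrow> (mindex \<Rightarrow> complex ^ 4 ^ 4)
      \<Rightarrow> mindex \<Rightarrow> complex ^ 4 ^ 4" where
  "Psi \<mu> W0 Gh B \<alpha> =
     (if \<alpha> = (0, 0) then mat 1
      else (\<chi> i j. kappa \<mu> i j \<alpha> * (matrix_inv W0 ** S_coeff \<mu> W0 Gh B \<alpha>) $ i $ j))"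

end

theory Submission
  imports Defs
begin

text \<open>
  Absolute convergence turns products of power series into Cauchy products, so the conjugacy
  equation reduces to its coefficients. At order zero it says that the columns of \<open>\<W>\<^sub>0\<close> are
  eigenvectors. At order \<open>\<alpha> \<noteq> 0\<close>, multiplication by the inverse of \<open>\<W>\<^sub>0\<close> (which exists because the four
  eigenvalues are distinct) diagonalises it: the \<open>(i,j)\<close> entry reads
  \<open>(\<alpha>\<^sub>1\<mu>\<^sub>1 + \<alpha>\<^sub>2\<mu>\<^sub>2 + \<mu>\<^sub>j - \<mu>\<^sub>i) w + a = (\<W>\<^sub>0\<^sup>-\<^sup>1 S\<^sub>\<alpha>)\<^sub>i\<^sub>j\<close>, which is solved by \<open>w\<close> off resonance and by
  \<open>a\<close> at resonance. The derivative series converges even on the boundary of the polydisc,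
  being coefficientwise the difference of two Cauchy products.
\<close>

section \<open>General facts on infinite sums and matrices\<close>

lemma has_sum_sum:
  fixes f :: "'k \<Rightarrow> 'a \<Rightarrow> 'b :: topological_comm_monoid_add"
  assumes "\<And>k. k \<in> K \<Longrightarrow> (f k has_sum s k) A"
  shows "((\<lambda>x. \<Sum>k\<in>K. f k x) has_sum (\<Sum>k\<in>K. s k)) A"
  using assms by (induction K rule: infinite_finite_induct) (auto intro: has_sum_add)

lemma has_sum_diff:
  fixes f g :: "'a \<Rightarrow> 'b :: real_normed_vector"
  assumes "(f has_sum a) A" and "(g has_sum b) A"
  shows "((\<lambda>x. f x - g x) has_sum (a - b)) A"
  using has_sum_add[OF assms(1), of "\<lambda>x. - g x" "- b"] assms(2) by (simp add: has_sum_uminus)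

lemma vector_4:
  "(vector [a, b, c, d] :: 'a::zero ^ 4) $ 1 = a"
  "(vector [a, b, c, d] :: 'a::zero ^ 4) $ 2 = b"
  "(vector [a, b, c, d] :: 'a::zero ^ 4) $ 3 = c"
  "(vector [a, b, c, d] :: 'a::zero ^ 4) $ 4 = d"
  by (simp_all add: vector_def)

lemma matrix_inv_right:
  assumes "invertible A" shows "A ** matrix_inv A = mat 1"
  using someI_ex[OF assms[unfolded invertible_def]] by (simp add: matrix_inv_def)

lemma matrix_diff_ldistrib:
  fixes A :: "'a::ring_1 ^ 'n ^ 'm"
  shows "A ** (B - C) = A ** B - A ** C"
  by (simp add: vec_eq_iff matrix_matrix_mult_def right_diff_distrib sum_subtractf)

section \<open>Products of power series\<close>

lemma has_sum_Cauchy_product: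
  fixes a b :: "mindex \<Rightarrow> complex"
  assumes a: "(a has_sum A) UNIV" and b: "(b has_sum B) UNIV"
  shows "((\<lambda>\<alpha>. \<Sum>\<beta> \<in> {..fst \<alpha>} \<times> {..snd \<alpha>}. a (fst \<alpha> - fst \<beta>, snd \<alpha> - snd \<beta>) * b \<beta>)
           has_sum A * B) UNIV"
proof -
  \<comment> \<open>Over the complex numbers unconditional summability is already absolute, so the
    double family is absolutely summable and may be summed in any grouping.\<close>
  have na: "(\<lambda>x. norm (a x)) summable_on UNIV" and nb: "(\<lambda>x. norm (b x)) summable_on UNIV"
    using a b summable_on_iff_abs_summable_on_complex by (auto simp: summable_on_def)
  have "(\<lambda>z. norm (case z of (x, y) \<Rightarrow> a x * b y)) summable_on UNIV \<times> UNIV"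
    unfolding Infinite_Sum.abs_summable_on_Sigma_iff using na nb
    by (auto simp: norm_mult abs_mult infsum_cmult_right' infsum_nonneg summable_on_cmult_right summable_on_cmult_left)
  then have "((\<lambda>(x, y). a x * b y) has_sum A * B) (UNIV \<times> UNIV)"
    by (intro has_sum_SigmaI[where g = "\<lambda>x. a x * B"])
      (use a b in \<open>auto intro: has_sum_cmult_right has_sum_cmult_left dest: abs_summable_summable\<close>)
  \<comment> \<open>Pairs are regrouped by their sum \<alpha>. Each group is a finite box, inside
    which the truncated subtraction of naturals is exact.\<close>
  also have "?this \<longleftrightarrow>
      ((\<lambda>(\<alpha>, \<beta>). a (fst \<alpha> - fst \<beta>, snd \<alpha> - snd \<beta>) * b \<beta>) has_sum A * B)
        (SIGMA \<alpha>:UNIV. {..fst \<alpha>} \<times> {..snd \<alpha>})"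
    by (rule has_sum_reindex_bij_witness
          [where i = "\<lambda>(\<alpha>, \<beta>). ((fst \<alpha> - fst \<beta>, snd \<alpha> - snd \<beta>), \<beta>)"
             and j = "\<lambda>(\<gamma>, \<beta>). ((fst \<gamma> + fst \<beta>, snd \<gamma> + snd \<beta>), \<beta>)"]) auto
  finally show ?thesis
    by (rule has_sum_SigmaD) (auto intro!: has_sum_finiteI)
qed

lemma monom2_diff_mult:
  assumes "fst \<beta> \<le> fst \<alpha>" "snd \<beta> \<le> snd \<alpha>"
  shows "monom2 \<sigma> (fst \<alpha> - fst \<beta>, snd \<alpha> - snd \<beta>) * monom2 \<sigma> \<beta> = monom2 \<sigma> \<alpha>"
proof -
  have "x ^ (m - n) * x ^ n = x ^ m" if "n \<le> m" for x :: complex and m n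
    using that by (simp flip: power_add)
  from this[OF assms(1), of "\<sigma> $ 1"] this[OF assms(2), of "\<sigma> $ 2"] show ?thesis
    unfolding monom2_def by (metis (no_types, lifting) fst_conv snd_conv mult.assoc mult.left_commute)
qed

definition mat_conv ::
    "(mindex \<Rightarrow> complex ^ 4 ^ 4) \<Rightarrow> (mindex \<Rightarrow> complex ^ 4 ^ 4) \<Rightarrow> mindex \<Rightarrow> complex ^ 4 ^ 4" where
  "mat_conv b c \<alpha> =
     (\<Sum>\<beta> \<in> {..fst \<alpha>} \<times> {..snd \<alpha>}. b (fst \<alpha> - fst \<beta>, snd \<alpha> - snd \<beta>) ** c \<beta>)"

text \<open>A relation that carries convergence along with the value: an equation with
  \<open>mat_series\<close> could hold through the default value 0 of a divergent sum.\<close>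

definition mat_has_series :: "(mindex \<Rightarrow> complex ^ 4 ^ 4) \<Rightarrow> complex ^ 2 \<Rightarrow> complex ^ 4 ^ 4 \<Rightarrow> bool" where
  "mat_has_series b \<sigma> M \<longleftrightarrow> (\<forall>i j. ((\<lambda>\<alpha>. b \<alpha> $ i $ j * monom2 \<sigma> \<alpha>) has_sum M $ i $ j) UNIV)"

text \<open>An entry of the matrix product is a finite sum over k of products of scalar series. The
  scalar Cauchy product applies to each k, and the two monomials in every term recombine to that of
  \<alpha>.\<close>

lemma mat_has_series_conv:
  assumes "mat_has_series b \<sigma> M" and "mat_has_series c \<sigma> N"
  shows "mat_has_series (mat_conv b c) \<sigma> (M ** N)"
  unfolding mat_has_series_def
proof (intro allI)
  fix i j
  have "((\<lambda>\<alpha>. \<Sum>\<beta> \<in> {..fst \<alpha>} \<times> {..snd \<alpha>}.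
            (b (fst \<alpha> - fst \<beta>, snd \<alpha> - snd \<beta>) $ i $ k
              * monom2 \<sigma> (fst \<alpha> - fst \<beta>, snd \<alpha> - snd \<beta>))
            * (c \<beta> $ k $ j * monom2 \<sigma> \<beta>)) has_sum M $ i $ k * N $ k $ j) UNIV" for k
    using has_sum_Cauchy_product assms unfolding mat_has_series_def by blast
  moreover have "(\<Sum>\<beta> \<in> {..fst \<alpha>} \<times> {..snd \<alpha>}.
            (b (fst \<alpha> - fst \<beta>, snd \<alpha> - snd \<beta>) $ i $ k
              * monom2 \<sigma> (fst \<alpha> - fst \<beta>, snd \<alpha> - snd \<beta>))
            * (c \<beta> $ k $ j * monom2 \<sigma> \<beta>))
       = (\<Sum>\<beta> \<in> {..fst \<alpha>} \<times> {..snd \<alpha>}.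
            b (fst \<alpha> - fst \<beta>, snd \<alpha> - snd \<beta>) $ i $ k * c \<beta> $ k $ j) * monom2 \<sigma> \<alpha>" for \<alpha> k
    unfolding sum_distrib_right
  proof (rule sum.cong)
    fix \<beta> assume "\<beta> \<in> {..fst \<alpha>} \<times> {..snd \<alpha>}"
    then have "monom2 \<sigma> \<alpha> = monom2 \<sigma> (fst \<alpha> - fst \<beta>, snd \<alpha> - snd \<beta>) * monom2 \<sigma> \<beta>"
      using monom2_diff_mult[of \<beta> \<alpha> \<sigma>] by auto
    then show "b (fst \<alpha> - fst \<beta>, snd \<alpha> - snd \<beta>) $ i $ k
          * monom2 \<sigma> (fst \<alpha> - fst \<beta>, snd \<alpha> - snd \<beta>) * (c \<beta> $ k $ j * monom2 \<sigma> \<beta>)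
        = b (fst \<alpha> - fst \<beta>, snd \<alpha> - snd \<beta>) $ i $ k * c \<beta> $ k $ j * monom2 \<sigma> \<alpha>"
      by (simp add: mult_ac)
  qed simp
  ultimately have *: "((\<lambda>\<alpha>. (\<Sum>\<beta> \<in> {..fst \<alpha>} \<times> {..snd \<alpha>}.
            b (fst \<alpha> - fst \<beta>, snd \<alpha> - snd \<beta>) $ i $ k * c \<beta> $ k $ j) * monom2 \<sigma> \<alpha>)
          has_sum M $ i $ k * N $ k $ j) UNIV" for k
    by simp
  have "mat_conv b c \<alpha> $ i $ j * monom2 \<sigma> \<alpha> = (\<Sum>k\<in>UNIV. (\<Sum>\<beta> \<in> {..fst \<alpha>} \<times> {..snd \<alpha>}.
            b (fst \<alpha> - fst \<beta>, snd \<alpha> - snd \<beta>) $ i $ k * c \<beta> $ k $ j) * monom2 \<sigma> \<alpha>)" for \<alpha>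
    unfolding mat_conv_def by (subst sum_distrib_right[symmetric], subst sum.swap)
      (simp add: matrix_matrix_mult_def)
  then show "((\<lambda>\<alpha>. mat_conv b c \<alpha> $ i $ j * monom2 \<sigma> \<alpha>) has_sum (M ** N) $ i $ j) UNIV"
    using has_sum_sum[of UNIV "\<lambda>k \<alpha>. (\<Sum>\<beta> \<in> {..fst \<alpha>} \<times> {..snd \<alpha>}.
            b (fst \<alpha> - fst \<beta>, snd \<alpha> - snd \<beta>) $ i $ k * c \<beta> $ k $ j) * monom2 \<sigma> \<alpha>", OF *]
    by (simp add: matrix_matrix_mult_def)
qed

section \<open>Weighted summability of the coefficient sequences\<close>

lemma ell1_series_summable:
  assumes "b \<in> ell1 \<delta>" and "\<sigma> \<in> polydisc \<delta>"
  shows "(\<lambda>\<alpha>. b \<alpha> * monom2 \<sigma> \<alpha>) summable_on UNIV"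
proof (rule abs_summable_summable, rule Infinite_Sum.abs_summable_on_comparison_test')
  show "(\<lambda>\<alpha>. cmod (b \<alpha>) * \<delta> ^ (fst \<alpha> + snd \<alpha>)) summable_on UNIV"
    using assms by (simp add: ell1_def)
  \<comment> \<open>Monotonicity of products needs \<delta> \<ge> 0, which the polydisc supplies
    through the norm of its first coordinate.\<close>
  have "cmod (\<sigma> $ 1) ^ m * cmod (\<sigma> $ 2) ^ n \<le> \<delta> ^ m * \<delta> ^ n" for m n
    using assms(2) order_trans[OF norm_ge_zero[of "\<sigma> $ 1"]]
    by (intro mult_mono power_mono) (auto simp: polydisc_def)
  then show "cmod (b \<alpha> * monom2 \<sigma> \<alpha>) \<le> cmod (b \<alpha>) * \<delta> ^ (fst \<alpha> + snd \<alpha>)" for \<alpha>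
    by (auto simp: norm_mult norm_power monom2_def power_add intro!: mult_left_mono)
qed

lemma mat_has_series_ell1:
  assumes "b \<in> ell1_mat \<delta>" and "\<sigma> \<in> polydisc \<delta>"
  shows "mat_has_series b \<sigma> (mat_series b \<sigma>)"
  using assms ell1_series_summable[OF _ assms(2)]
  by (simp add: mat_has_series_def mat_series_def power_series_def ell1_mat_def has_sum_infsum)

text \<open>One coefficient does not affect summability. Order zero is left out of the comparison
  because \<open>Acoeff\<close> has \<open>Omega\<close> there, which \<open>B\<close> does not
  bound.\<close>

lemma ell1_mono:
  assumes "b \<in> ell1 \<delta>" "\<delta> \<ge> 0" and "\<And>\<alpha>. \<alpha> \<noteq> (0, 0) \<Longrightarrow> cmod (c \<alpha>) \<le> cmod (b \<alpha>)"
  shows "c \<in> ell1 \<delta>"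
proof -
  let ?w = "\<lambda>\<alpha>::mindex. \<delta> ^ (fst \<alpha> + snd \<alpha>)"
  have "(\<lambda>\<alpha>. cmod (b \<alpha>) * ?w \<alpha>) summable_on (UNIV - {(0, 0)})"
    using assms(1) by (auto simp: ell1_def intro: summable_on_subset_banach)
  then have "(\<lambda>\<alpha>. norm (cmod (c \<alpha>) * ?w \<alpha>)) summable_on (UNIV - {(0, 0)})"
    by (rule Infinite_Sum.abs_summable_on_comparison_test')
      (use assms in \<open>auto simp: abs_mult intro!: mult_right_mono\<close>)
  then have "(\<lambda>\<alpha>. cmod (c \<alpha>) * ?w \<alpha>) summable_on insert (0, 0) (UNIV - {(0, 0)})"
    using assms(2) by (subst summable_on_insert_iff) (simp add: abs_mult)
  then show ?thesis by (simp add: ell1_def insert_absorb)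
qed

text \<open>Serves \<open>Wcoeff\<close>: left multiplication by \<open>W0\<close> turns entries
  into fixed linear combinations, controlled by the triangle inequality.\<close>

lemma ell1_sum:
  assumes "finite K" and "\<And>k. k \<in> K \<Longrightarrow> b k \<in> ell1 \<delta>" and "\<delta> \<ge> 0"
  shows "(\<lambda>\<alpha>. \<Sum>k\<in>K. c k * b k \<alpha>) \<in> ell1 \<delta>"
proof -
  have "((\<lambda>\<alpha>. \<Sum>k\<in>K. cmod (c k) * (cmod (b k \<alpha>) * \<delta> ^ (fst \<alpha> + snd \<alpha>))) has_sum
      (\<Sum>k\<in>K. cmod (c k) * (\<Sum>\<^sub>\<infinity>\<alpha>. cmod (b k \<alpha>) * \<delta> ^ (fst \<alpha> + snd \<alpha>)))) UNIV"
    using assms by (intro has_sum_sum has_sum_cmult_right has_sum_infsum) (auto simp: ell1_def)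
  then have "(\<lambda>\<alpha>. \<Sum>k\<in>K. cmod (c k) * (cmod (b k \<alpha>) * \<delta> ^ (fst \<alpha> + snd \<alpha>))) summable_on UNIV"
    by (rule has_sum_imp_summable)
  then have "(\<lambda>\<alpha>. norm (cmod (\<Sum>k\<in>K. c k * b k \<alpha>) * \<delta> ^ (fst \<alpha> + snd \<alpha>))) summable_on UNIV"
  proof (rule Infinite_Sum.abs_summable_on_comparison_test')
    fix \<alpha> :: mindex
    have "cmod (\<Sum>k\<in>K. c k * b k \<alpha>) \<le> (\<Sum>k\<in>K. cmod (c k) * cmod (b k \<alpha>))"
      by (rule order_trans[OF norm_sum]) (simp add: norm_mult)
    then show "norm (cmod (\<Sum>k\<in>K. c k * b k \<alpha>) * \<delta> ^ (fst \<alpha> + snd \<alpha>))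
        \<le> (\<Sum>k\<in>K. cmod (c k) * (cmod (b k \<alpha>) * \<delta> ^ (fst \<alpha> + snd \<alpha>)))"
      using assms(3) by (simp add: abs_mult mult_right_mono flip: sum_distrib_right mult.assoc)
  qed
  then show ?thesis using assms(3) by (simp add: ell1_def abs_mult)
qed

lemma Acoeff_ell1:
  assumes "B \<in> ell1_mat \<delta>" "\<delta> \<ge> 0"
  shows "Acoeff \<mu> B \<in> ell1_mat \<delta>"
  unfolding ell1_mat_def
proof (intro CollectI allI)
  fix i j
  show "(\<lambda>\<alpha>. Acoeff \<mu> B \<alpha> $ i $ j) \<in> ell1 \<delta>"
    by (rule ell1_mono[of "\<lambda>\<alpha>. B \<alpha> $ i $ j"]) (use assms in \<open>auto simp: Acoeff_def ell1_mat_def\<close>)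
qed

lemma Wcoeff_ell1:
  assumes "B \<in> ell1_mat \<delta>" "\<delta> \<ge> 0"
  shows "Wcoeff \<mu> W0 B \<in> ell1_mat \<delta>"
  unfolding ell1_mat_def
proof (intro CollectI allI)
  fix i j
  have "(\<lambda>\<alpha>. Wtilde \<mu> B \<alpha> $ k $ j) \<in> ell1 \<delta>" for k
    by (rule ell1_mono[of "\<lambda>\<alpha>. B \<alpha> $ k $ j"]) (use assms in \<open>auto simp: Wtilde_def ell1_mat_def\<close>)
  then show "(\<lambda>\<alpha>. Wcoeff \<mu> W0 B \<alpha> $ i $ j) \<in> ell1 \<delta>"
    using ell1_sum[of UNIV "\<lambda>k \<alpha>. Wtilde \<mu> B \<alpha> $ k $ j" \<delta> "\<lambda>k. W0 $ i $ k"] assms(2)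
    by (simp add: Wcoeff_def matrix_matrix_mult_def)
qed

section \<open>Eigenvector matrices and distinctness of the eigenvalues\<close>

lemma matrix_mult_eigenvector_columns:
  fixes A V :: "complex ^ 'n ^ 'n"
  assumes "\<And>j. eigenvector_of A (l $ j) (column j V)"
  shows "A ** V = V ** (\<chi> i j. if i = j then l $ i else 0)"
proof -
  have "(\<Sum>k\<in>UNIV. A $ i $ k * V $ k $ j) = V $ i $ j * l $ j" for i j
    using assms[of j]
    by (simp add: eigenvector_of_def vec_eq_iff matrix_vector_mult_def column_def mult.commute)
  then show ?thesis
    by (simp add: vec_eq_iff matrix_matrix_mult_def if_distrib cong: if_cong)
qed

lemma invertible_eigenvector_columns:
  fixes A V :: "complex ^ 'n ^ 'n"
  assumes eig: "\<And>j. eigenvector_of A (l $ j) (column j V)"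
    and dist: "inj (($) l)"
  shows "invertible V"
proof -
  \<comment> \<open>Since A V = V diag(l), a kernel vector z of V satisfies V diag(l) z = A V z = 0;
    subtracting c z stays in the kernel.\<close>
  have step: "V *v (\<chi> i. (l $ i - c) * z $ i) = 0" if "V *v z = 0" for z c
  proof -
    have "V *v (\<chi> i. (l $ i - c) * z $ i)
        = V *v ((\<chi> i j. if i = j then l $ i else 0) *v z) - c *s (V *v z)"
      by (simp add: vec_eq_iff matrix_vector_mult_def if_distrib if_distribR algebra_simps
            sum_subtractf sum_distrib_left cong: if_cong)
    also have "V *v ((\<chi> i j. if i = j then l $ i else 0) *v z) = A *v (V *v z)"
      by (simp add: matrix_vector_mul_assoc matrix_mult_eigenvector_columns[OF eig])
    finally show ?thesis using that by simp
  qed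
  \<comment> \<open>The kernel of \<open>V\<close> is invariant under \<open>diag(l) - c\<close>, so a product of such factors isolates one
    coordinate of a kernel vector.\<close>
  have prod: "V *v (\<chi> i. (\<Prod>k\<in>K. l $ i - l $ k) * z $ i) = 0" if "V *v z = 0" "finite K" for z K
    using that(2)
  proof induction
    case empty
    then show ?case using that(1) by (simp add: vec_lambda_eta)
  next
    case (insert k K)
    from step[OF insert.IH, of "l $ k"] insert.hyps show ?case by (simp add: mult_ac)
  qed
  have "z = 0" if z: "V *v z = 0" for z
  proof -
    have "z $ j = 0" for j
    proof -
      \<comment> \<open>At a coordinate i other than j the product contains the factor k = i and
        vanishes. Only coordinate j survives, scaled by \<open>?c\<close>, which is nonzero because
        the eigenvalues are distinct.\<close>
      let ?c = "\<Prod>k\<in>UNIV - {j}. l $ j - l $ k"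
      have "(\<Prod>k\<in>UNIV - {j}. l $ i - l $ k) = 0" if "i \<noteq> j" for i
        using that by (auto simp: prod_zero_iff)
      then have "(\<chi> i. (\<Prod>k\<in>UNIV - {j}. l $ i - l $ k) * z $ i) = axis j (?c * z $ j)"
        by (auto simp: vec_eq_iff axis_def)
      then have "V *v axis j (?c * z $ j) = 0"
        using prod[OF z, of "UNIV - {j}"] by simp
      then have "(?c * z $ j) *s column j V = 0"
        by (simp add: vec_eq_iff matrix_vector_mult_def axis_def column_def mult.commute
              if_distrib cong: if_cong)
      moreover have "column j V \<noteq> 0" using eig by (simp add: eigenvector_of_def)
      moreover have "?c \<noteq> 0" using dist by (auto simp: inj_def)
      ultimately show ?thesis by simp
    qed
    then show ?thesis by (simp add: vec_eq_iff)
  qed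
  then have "inj ((*v) V)"
    by (simp add: vec.inj_iff_eq_0)
  then show ?thesis
    by (simp add: invertible_left_inverse matrix_left_invertible_injective)
qed

text \<open>Half of \<theta> lies strictly between 0 and pi/2, so its sine and cosine are positive
  and the four values lie in four different open quadrants.\<close>

lemma inj_eigs:
  assumes "\<mu>h > 0" "0 < \<theta>" "\<theta> < pi"
  shows "inj (($) (eigs \<mu>h \<theta>))"
proof -
  define s where "s = sqrt (sqrt (1 + \<mu>h))"
  have "s > 0" using assms by (simp add: s_def)
  moreover have "cos (\<theta> / 2) > 0" "sin (\<theta> / 2) > 0"
    using assms by (auto intro!: cos_gt_zero sin_gt_zero)
  ultimately have pos: "s * cos (\<theta> / 2) > 0" "s * sin (\<theta> / 2) > 0" by simp_all
  have e: "eigs \<mu>h \<theta> = vector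
      [Complex (- (s * cos (\<theta> / 2))) (- (s * sin (\<theta> / 2))),
       Complex (- (s * cos (\<theta> / 2))) (s * sin (\<theta> / 2)),
       Complex (s * cos (\<theta> / 2)) (s * sin (\<theta> / 2)),
       Complex (s * cos (\<theta> / 2)) (- (s * sin (\<theta> / 2)))]"
    unfolding eigs_def Let_def s_def[symmetric]
    by (intro arg_cong[where f = vector]) (auto simp: complex_eq_iff Re_exp Im_exp)
  show ?thesis
    unfolding inj_def forall_4 e vector_4 using pos by auto
qed

section \<open>The conjugacy equation coefficient by coefficient\<close>

lemma mat_conv_hat_conv:
  assumes "\<alpha> \<noteq> (0, 0)"
  shows "mat_conv b c \<alpha> = b \<alpha> ** c (0, 0) + hat_conv b c \<alpha> + b (0, 0) ** c \<alpha>"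
proof -
  let ?H = "{\<beta>. fst \<beta> \<le> fst \<alpha> \<and> snd \<beta> \<le> snd \<alpha> \<and> \<beta> \<noteq> (0, 0) \<and> \<beta> \<noteq> \<alpha>}"
  \<comment> \<open>The box is the index set of \<open>hat_conv\<close> with two opposite corners
    restored; these differ as \<alpha> is nonzero, so each contributes its own term.\<close>
  have eq: "{..fst \<alpha>} \<times> {..snd \<alpha>} = insert (0, 0) (insert \<alpha> ?H)"
    by auto
  moreover have "finite ?H"
    by (rule finite_subset[of _ "{..fst \<alpha>} \<times> {..snd \<alpha>}"]) auto
  ultimately show ?thesis
    using assms by (simp add: mat_conv_def hat_conv_def add_ac)
qed

lemma coefficient_identity:
  assumes G0: "Gh (0, 0) ** W0 = W0 ** Omega \<mu>" and inv: "invertible W0" and B: "B = Psi \<mu> W0 Gh B"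
  shows "(mat_conv Gh (Wcoeff \<mu> W0 B) \<alpha> - mat_conv (Wcoeff \<mu> W0 B) (Acoeff \<mu> B) \<alpha>) $ i $ j
           = stable_dot \<mu> \<alpha> * Wcoeff \<mu> W0 B \<alpha> $ i $ j"
proof -
  define W A T where "W = Wcoeff \<mu> W0 B" and "A = Acoeff \<mu> B" and "T = Wtilde \<mu> B"
  \<comment> \<open>The fixed point inherits order zero from \<open>Psi\<close>, so the series of
    \<open>Wcoeff\<close> starts with \<open>W0\<close> itself.\<close>
  have T0: "T (0, 0) = mat 1"
    using B unfolding T_def Wtilde_def Psi_def by (simp add: fun_eq_iff)
  have W: "W \<alpha> = W0 ** T \<alpha>" for \<alpha>
    by (simp add: W_def T_def Wcoeff_def)
  have A0: "A (0, 0) = Omega \<mu>" and W_0: "W (0, 0) = W0"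
    using T0 W by (simp_all add: A_def Acoeff_def)
  show ?thesis
  proof (cases "\<alpha> = (0, 0)")
    case True
    then show ?thesis
      using G0 A0 W_0 by (simp add: mat_conv_def stable_dot_def flip: W_def A_def)
  next
    case False
    define S where "S = S_coeff \<mu> W0 Gh B \<alpha>"
    define X :: "complex ^ 4 ^ 4" where "X = (\<chi> i j. stable_dot \<mu> \<alpha> * T \<alpha> $ i $ j)"
    \<comment> \<open>The order-\<alpha> equation in the eigenbasis. The commutator with
      \<open>Omega\<close> acts on entries by scalars, so the sixteen equations decouple.\<close>
    have "stable_dot \<mu> \<alpha> * T \<alpha> $ i $ j + T \<alpha> $ i $ j * \<mu> $ j - \<mu> $ i * T \<alpha> $ i $ j + A \<alpha> $ i $ j
        = (matrix_inv W0 ** S) $ i $ j" for i j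
    proof -
      have b: "B \<alpha> $ i $ j = kappa \<mu> i j \<alpha> * (matrix_inv W0 ** S) $ i $ j"
        using False by (subst B) (simp add: Psi_def S_def)
      show ?thesis
      proof (cases "\<alpha> \<in> Res \<mu> i j")
        case True
        then show ?thesis using b False by (simp add: T_def A_def Wtilde_def Acoeff_def kappa_def)
      next
        case res: False
        \<comment> \<open>\<open>Res\<close> also demands order at least 1; only because \<alpha> is
          nonzero does lying outside \<open>Res\<close> mean a nonzero divisor.\<close>
        then have "stable_dot \<mu> \<alpha> + \<mu> $ j - \<mu> $ i \<noteq> 0"
          using False by (cases \<alpha>) (auto simp: Res_def)
        moreover have "stable_dot \<mu> \<alpha> * t + t * \<mu> $ j - \<mu> $ i * t
            = (stable_dot \<mu> \<alpha> + \<mu> $ j - \<mu> $ i) * t" for t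
          by (simp add: algebra_simps)
        ultimately show ?thesis
          using b res False by (simp add: T_def A_def Wtilde_def Acoeff_def kappa_def)
      qed
    qed
    then have X: "X = matrix_inv W0 ** S + Omega \<mu> ** T \<alpha> - T \<alpha> ** Omega \<mu> - A \<alpha>"
      by (simp add: X_def vec_eq_iff matrix_matrix_mult_def Omega_def if_distrib if_distribR
            algebra_simps cong: if_cong)
    \<comment> \<open>The unknowns of order \<alpha> occur only in the extreme terms of the two
      products; what remains is \<open>S\<close>.\<close>
    have "mat_conv Gh W \<alpha> - mat_conv W A \<alpha>
        = S + Gh (0, 0) ** W0 ** T \<alpha> - W0 ** T \<alpha> ** Omega \<mu> - W0 ** A \<alpha>"
      using False A0 W_0
      by (simp add: mat_conv_hat_conv S_def S_coeff_def W matrix_mul_assoc flip: W_def A_def)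
    also have "S = W0 ** (matrix_inv W0 ** S)"
      using inv by (simp add: matrix_mul_assoc matrix_inv_right)
    \<comment> \<open>\<open>G0\<close> moves \<open>W0\<close> to the left of \<open>Omega\<close>,
      after which it is a common left factor.\<close>
    also have "W0 ** (matrix_inv W0 ** S) + Gh (0, 0) ** W0 ** T \<alpha> - W0 ** T \<alpha> ** Omega \<mu> - W0 ** A \<alpha>
        = W0 ** X"
      unfolding X G0 by (simp add: matrix_mul_assoc matrix_diff_ldistrib matrix_add_ldistrib)
    also have "(W0 ** X) $ i $ j = stable_dot \<mu> \<alpha> * W \<alpha> $ i $ j"
      by (simp add: X_def W matrix_matrix_mult_def sum_distrib_left mult_ac)
    finally show ?thesis by (simp add: W_def A_def)
  qed
qed

theorem theorem6p3:
  fixes \<mu>h \<nu>h \<theta> \<delta> :: real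
    and \<mu> :: "complex ^ 4"
    and p :: "nat \<times> nat \<Rightarrow> complex ^ 4"
    and Gh B :: "nat \<times> nat \<Rightarrow> complex ^ 4 ^ 4"
    and W0 :: "complex ^ 4 ^ 4"
  assumes "\<mu>h > 0" and "\<nu>h > 0" and "\<delta> > 0"
    and "pi / 2 < \<theta>" and "\<theta> < pi" and "tan \<theta> = - sqrt \<mu>h"
    and "\<mu> = eigs \<mu>h \<theta>"
    and "\<And>j. eigenvector_of (DG \<mu>h \<nu>h 0) (\<mu> $ j) (column j W0)"
    and "is_parameterization \<mu>h \<nu>h \<mu> \<delta> p"
    and "is_expansion_on (polydisc \<delta>) (\<lambda>\<sigma>. DG \<mu>h \<nu>h (vec_series p \<sigma>)) Gh"
    and "B \<in> ell1_mat \<delta>"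
    and "B = Psi \<mu> W0 Gh B"
  shows "\<forall>\<sigma>\<in>polydisc \<delta>.
    (\<forall>i j. dir_converges \<mu> (\<lambda>\<alpha>. Wcoeff \<mu> W0 B \<alpha> $ i $ j) \<sigma>) \<and>
    DG \<mu>h \<nu>h (vec_series p \<sigma>) ** mat_series (Wcoeff \<mu> W0 B) \<sigma>
      = mat_dir_deriv \<mu> (Wcoeff \<mu> W0 B) \<sigma>
        + mat_series (Wcoeff \<mu> W0 B) \<sigma> ** mat_series (Acoeff \<mu> B) \<sigma>"
proof (rule ballI)
  fix \<sigma> assume \<sigma>: "\<sigma> \<in> polydisc \<delta>"
  let ?W = "Wcoeff \<mu> W0 B" and ?A = "Acoeff \<mu> B" and ?G = "DG \<mu>h \<nu>h (vec_series p \<sigma>)"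
  \<comment> \<open>Kept general in the point: it is used at 0, to read off the constant
    coefficient, as well as at the given point.\<close>
  have G: "mat_has_series Gh \<sigma> (DG \<mu>h \<nu>h (vec_series p \<sigma>))" if "\<sigma> \<in> polydisc \<delta>" for \<sigma>
    using assms(10) that by (simp add: is_expansion_on_def mat_has_series_def)
  have W: "mat_has_series ?W \<sigma> (mat_series ?W \<sigma>)" and A: "mat_has_series ?A \<sigma> (mat_series ?A \<sigma>)"
    using assms(3,11) \<sigma> by (auto intro!: mat_has_series_ell1 Wcoeff_ell1 Acoeff_ell1)
  have inv: "invertible W0"
    using invertible_eigenvector_columns[OF assms(8)] inj_eigs assms(1,4,5,7) pi_gt_zero
    by (metis half_gt_zero order_less_trans)
  have "Gh (0, 0) $ i $ j = DG \<mu>h \<nu>h 0 $ i $ j" for i j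
  proof -
    have "((\<lambda>\<alpha>. Gh \<alpha> $ i $ j * monom2 0 \<alpha>) has_sum DG \<mu>h \<nu>h 0 $ i $ j) UNIV"
      using G[of 0] assms(3,9) by (simp add: polydisc_def is_parameterization_def mat_has_series_def)
    \<comment> \<open>At the origin every monomial but the constant one vanishes.\<close>
    moreover have "((\<lambda>\<alpha>. Gh \<alpha> $ i $ j * monom2 0 \<alpha>) has_sum Gh (0, 0) $ i $ j) UNIV"
      by (rule has_sum_finite_neutralI[of "{(0, 0)}"]) (auto simp: monom2_def power_0_left)
    ultimately show ?thesis using has_sum_unique by blast
  qed
  then have "Gh (0, 0) = DG \<mu>h \<nu>h 0" by (simp add: vec_eq_iff)
  then have G0: "Gh (0, 0) ** W0 = W0 ** Omega \<mu>"
    using matrix_mult_eigenvector_columns[OF assms(8)] by (simp add: Omega_def)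
  \<comment> \<open>As a \<open>has_sum\<close> this yields both convergence of the derivative
    series and its value.\<close>
  have D: "((\<lambda>\<alpha>. dir_coeff \<mu> (\<lambda>\<alpha>. ?W \<alpha> $ i $ j) \<alpha> * monom2 \<sigma> \<alpha>) has_sum
      (?G ** mat_series ?W \<sigma> - mat_series ?W \<sigma> ** mat_series ?A \<sigma>) $ i $ j) UNIV" for i j
  proof -
    have "((\<lambda>\<alpha>. mat_conv Gh ?W \<alpha> $ i $ j * monom2 \<sigma> \<alpha> - mat_conv ?W ?A \<alpha> $ i $ j * monom2 \<sigma> \<alpha>)
        has_sum ((?G ** mat_series ?W \<sigma>) $ i $ j - (mat_series ?W \<sigma> ** mat_series ?A \<sigma>) $ i $ j)) UNIV"
      using mat_has_series_conv[OF G[OF \<sigma>] W] mat_has_series_conv[OF W A]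
      unfolding mat_has_series_def by (intro has_sum_diff) auto
    then show ?thesis
      using coefficient_identity[OF G0 inv assms(12)]
      by (simp add: dir_coeff_def flip: left_diff_distrib)
  qed
  then have "mat_dir_deriv \<mu> ?W \<sigma>
      = ?G ** mat_series ?W \<sigma> - mat_series ?W \<sigma> ** mat_series ?A \<sigma>"
    by (simp add: mat_dir_deriv_def power_series_def vec_eq_iff infsumI)
  moreover have "\<forall>i j. dir_converges \<mu> (\<lambda>\<alpha>. ?W \<alpha> $ i $ j) \<sigma>"
    using D by (auto simp: dir_converges_def summable_on_def)
  ultimately show "(\<forall>i j. dir_converges \<mu> (\<lambda>\<alpha>. ?W \<alpha> $ i $ j) \<sigma>) \<and>
      ?G ** mat_series ?W \<sigma> = mat_dir_deriv \<mu> ?W \<sigma> + mat_series ?W \<sigma> ** mat_series ?A \<sigma>"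
    by simp
qed

end
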